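(* Let $\mathcal{P}$ be a probability distribution on $\mathbb{R}^d$ such that $d$ points chosen independently from $\mathcal{P}$ are almost surely affinely independent, and let $Z_n$ denote the convex hull of $n$ points chosen independently from $\mathcal{P}$. If $E[f_{d-1}(Z_n)] \approx A n^{c}$ for some constants $A>0$ and $c>0$, then there exists an integer $n_0$ such that for every $n \ge n_0$, $$E[f_{d-1}(Z_{n+1})] > E[f_{d-1}(Z_n)].$$
   Context: $f_{d-1}(Z_n)$ denotes the number of facets ($(d-1)$-dimensional faces) of the polytope $Z_n$. The notation $a_n \approx b_n$ means that $a_n / b_n \to 1$ as $n \to \infty$. *)

theory Defs
  imports "HOL-Probability.Probability" "HOL-Library.Landau_Symbols"
begin

definition num_facets :: "'a::euclidean_space set \<Rightarrow> nat" where
  "num_facets Z = card {F. F face_of Z \<and> aff_dim F = int DIM('a) - 1}"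

definition exp_facets :: "'a::euclidean_space measure \<Rightarrow> nat \<Rightarrow> real" where
  "exp_facets P n =
     integral\<^sup>L (PiM {..<n} (\<lambda>_. P)) (\<lambda>X. real (num_facets (convex hull (X ` {..<n}))))"

end

theory Submission
  imports Defs "HOL-Real_Asymp.Real_Asymp"
begin

text \<open>
  Let \<open>F\<^sub>n\<close> be the expected number of facets of \<open>Z\<^sub>n\<close> and \<open>C\<close> the binomial
  coefficient. A hyperplane \<open>H\<close> carries a facet of the hull of a subsample iff the subsample has at
  least \<open>d\<close> points on \<open>H\<close> and misses one of the open sides of \<open>H\<close>. Comparing, for each \<open>H\<close>,
  the subsamples of size \<open>r\<close> with those of size \<open>n - 1\<close> gives
  \<open>C(n, r) F\<^sub>r \<ge> (\<alpha> + d \<gamma>) F\<^sub>n + n \<gamma> (F\<^bsub>n-1\<^esub> - F\<^sub>n)\<close> with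
  \<open>\<alpha> = C(n-d, r-d)\<close> and \<open>\<gamma> = C(n-d-2, r-d-1)\<close>. If \<open>F\<^bsub>n-1\<^esub> \<ge> F\<^sub>n\<close> for arbitrarily large
  \<open>n\<close>, then \<open>r \<approx> \<rho> n\<close> yields in the limit \<open>\<rho>\<^sup>c \<ge> \<rho>\<^sup>d (1 + d \<rho> (1 - \<rho>))\<close>. As
  \<open>\<rho> \<rightarrow> 1\<close> the right-hand side is \<open>1 - O((1 - \<rho>)\<^sup>2)\<close> whereas the left-hand side is
  \<open>1 - c (1 - \<rho>) + o(1 - \<rho>)\<close>, so this fails for \<open>\<rho>\<close> close to \<open>1\<close>.
\<close>

subsection \<open>Subsets supporting a hyperplane\<close>

text \<open>Each such set is \<open>D\<close> together with a free choice of
  \<open>r - card D\<close> elements outside \<open>D\<close> and \<open>E\<close>.\<close>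

lemma card_subsets_between:
  assumes "finite S" "D \<subseteq> S" "E \<subseteq> S" "D \<inter> E = {}" "card D \<le> r"
  shows "card {R. R \<subseteq> S \<and> card R = r \<and> D \<subseteq> R \<and> R \<inter> E = {}} =
           (card S - card D - card E) choose (r - card D)"
proof -
  have fin: "finite D" "finite E" using assms by (auto intro: finite_subset)
  have "bij_betw (\<lambda>R. R \<union> D) {K. K \<subseteq> S - D - E \<and> card K = r - card D}
          {R. R \<subseteq> S \<and> card R = r \<and> D \<subseteq> R \<and> R \<inter> E = {}}"
  proof (rule bij_betw_byWitness[where f' = "\<lambda>R. R - D"])
    show "(\<lambda>R. R \<union> D) ` {K. K \<subseteq> S - D - E \<and> card K = r - card D}
        \<subseteq> {R. R \<subseteq> S \<and> card R = r \<and> D \<subseteq> R \<and> R \<inter> E = {}}"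
    proof clarify
      fix K assume K: "K \<subseteq> S - D - E" "card K = r - card D"
      have "finite K" using K assms(1) by (meson Diff_subset finite_subset subset_trans)
      then have "card (K \<union> D) = card K + card D"
        using K fin by (intro card_Un_disjoint) auto
      then show "K \<union> D \<subseteq> S \<and> card (K \<union> D) = r \<and> D \<subseteq> K \<union> D \<and> (K \<union> D) \<inter> E = {}"
        using K assms by auto
    qed
    show "(\<lambda>R. R - D) ` {R. R \<subseteq> S \<and> card R = r \<and> D \<subseteq> R \<and> R \<inter> E = {}}
        \<subseteq> {K. K \<subseteq> S - D - E \<and> card K = r - card D}"
      using fin by (auto simp: card_Diff_subset)
  qed auto
  then have "card {R. R \<subseteq> S \<and> card R = r \<and> D \<subseteq> R \<and> R \<inter> E = {}} = 
      card {K. K \<subseteq> S - D - E \<and> card K = r - card D}"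
    by (simp add: bij_betw_same_card)
  also have "\<dots> = card (S - D - E) choose (r - card D)"
    using assms(1) by (intro n_subsets) auto
  also have "card (S - D - E) = card S - card D - card E"
  proof -
    have "card (S - D - E) = card (S - D) - card E"
      using assms fin by (intro card_Diff_subset) auto
    then show ?thesis using assms fin by (simp add: card_Diff_subset)
  qed
  finally show ?thesis .
qed

text \<open>For indices on a hyperplane (\<open>M\<close>) and on its two open sides (\<open>L\<close>, \<open>U\<close>):
  the hyperplane carries a facet of the hull of the points indexed by \<open>R\<close>.\<close>

definition supports :: "nat \<Rightarrow> 'i set \<Rightarrow> 'i set \<Rightarrow> 'i set \<Rightarrow> 'i set \<Rightarrow> bool" where
  "supports d M L U R \<longleftrightarrow> d \<le> card (M \<inter> R) \<and> (L \<inter> R = {} \<or> U \<inter> R = {})"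

text \<open>The sampling inequality for a single hyperplane. The term
  \<open>\<gamma> * card S\<close> stands on the right so that comparing \<open>S\<close> with its
  deletions needs no subtraction in \<open>nat\<close>. If \<open>S\<close> is supported, either
  \<open>M\<close> has exactly \<open>d\<close> elements and the \<open>d\<close> deletions inside
  \<open>M\<close> fail, or a spare element of \<open>M\<close> yields at least
  \<open>\<gamma> * d\<close> extra subsets. If \<open>S\<close> is not supported, every supported
  deletion pays for its own \<gamma> subsets.\<close>

lemma supports_subset_count:
  fixes S :: "'i set"
  assumes S: "finite S" "S = M \<union> L \<union> U" and disj: "M \<inter> L = {}" "M \<inter> U = {}" "L \<inter> U = {}"
    and r: "d + 1 \<le> r" "r < card S"
  defines "\<alpha> \<equiv> (card S - d) choose (r - d)"
    and "\<gamma> \<equiv> (card S - d - 2) choose (r - d - 1)"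
  shows "(\<alpha> + \<gamma> * d) * of_bool (supports d M L U S)
           + \<gamma> * (\<Sum>p\<in>S. of_bool (supports d M L U (S - {p})))
         \<le> card {R. R \<subseteq> S \<and> card R = r \<and> supports d M L U R}
           + \<gamma> * card S * of_bool (supports d M L U S)"
proof -
  define B where "B D E = {R. R \<subseteq> S \<and> card R = r \<and> D \<subseteq> R \<and> R \<inter> E = {}}" for D E :: "'i set"
  define Q where "Q = {R. R \<subseteq> S \<and> card R = r \<and> supports d M L U R}"
  define T where "T = {p\<in>S. supports d M L U (S - {p})}"
  have finB: "finite (B D E)" for D E using S(1) unfolding B_def by simp
  have finQ: "finite Q" using S(1) unfolding Q_def by simp
  have finT: "finite T" using S(1) unfolding T_def by simp
  have sumT: "(\<Sum>p\<in>S. of_bool (supports d M L U (S - {p}))) = card T"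
    using S(1) by (simp add: T_def Int_def of_bool_def sum.If_cases)
  have OS: "M \<inter> S = M" "L \<inter> S = L" "U \<inter> S = U" "finite M"
    using S by auto
  show ?thesis
  proof (cases "supports d M L U S")
    case True
    then have dO: "d \<le> card M" and LU: "L = {} \<or> U = {}" unfolding supports_def by (auto simp: OS)
    \<comment> \<open>One side is empty for all of \<open>S\<close>, hence for every
      \<open>R\<close>; only \<open>d\<close> indices of \<open>M\<close> in \<open>R\<close> have
      to be secured.\<close>
    have inQ: "R \<in> Q" if "R \<subseteq> S" "card R = r" "D \<subseteq> R" "D \<subseteq> M" "card D = d" for R D
    proof -
      have "card D \<le> card (M \<inter> R)"
        using that OS by (intro card_mono) auto
      then show ?thesis using that LU unfolding Q_def supports_def by auto
    qed
    obtain D where D: "D \<subseteq> M" "card D = d" using dO by (meson obtain_subset_with_card_n)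
    have Dfin: "finite D" using D OS finite_subset by auto
    have cB: "card (B D {}) = \<alpha>"
      using card_subsets_between[of S D "{}" r] D r S unfolding B_def \<alpha>_def by auto
    show ?thesis
    proof (cases "card M = d")
      case True
      have DO: "D = M" using D OS True by (simp add: card_subset_eq)
      \<comment> \<open>Deleting a point of \<open>M\<close> leaves fewer than \<open>d\<close>, so
        \<open>card T \<le> card S - d\<close>. This gap of \<open>d\<close> absorbs the term
        \<open>\<gamma> * d\<close>.\<close>
      have "\<not> supports d M L U (S - {p})" if "p \<in> M" for p
      proof -
        have "card (M \<inter> (S - {p})) < card M"
          using that OS by (intro psubset_card_mono) auto
        then show ?thesis using True unfolding supports_def by auto
      qed
      then have "T \<subseteq> S - M" unfolding T_def by auto
      then have "card T \<le> card (S - M)" using S by (intro card_mono) auto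
      also have "\<dots> = card S - d" using S OS True by (subst card_Diff_subset) auto
      finally have "card T + d \<le> card S" using r by simp
      then have g: "\<gamma> * (card T + d) \<le> \<gamma> * card S" by (rule mult_le_mono2)
      have "B D {} \<subseteq> Q" using inQ D unfolding B_def by auto
      then have "\<alpha> \<le> card Q" using card_mono[OF finQ] cB by metis
      then show ?thesis
        using g \<open>supports d M L U S\<close> unfolding sumT Q_def[symmetric] by (simp add: algebra_simps)
    next
      case False
      then have "D \<noteq> M" using D by auto
      then obtain z where z: "z \<in> M" "z \<notin> D" using D by auto
      \<comment> \<open>Exchanging \<open>e\<close> for the spare element \<open>z\<close> keeps
        \<open>d\<close> indices in \<open>M\<close>. Sets in \<open>C e\<close> contain all of
        \<open>D\<close> except \<open>e\<close>, so these families are disjoint from each other and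
        from \<open>B D {}\<close>.\<close>
      define C where "C e = B (insert z (D - {e})) {e}" for e
      have cC: "\<gamma> \<le> card (C e)" if "e \<in> D" for e
      proof -
        have c: "card (insert z (D - {e})) = d" using z Dfin D that
          by (simp add: card_insert_if) (metis One_nat_def Suc_pred card_gt_0_iff empty_iff)
        have "card (C e) = (card S - d - 1) choose (r - d)"
          using card_subsets_between[of S "insert z (D - {e})" "{e}" r] c D r S z that
          unfolding B_def C_def by auto
        \<comment> \<open>Both arguments are written as successors so that Pascal's rule exhibits
          \<gamma> as one of two summands.\<close>
        also have "card S - d - 1 = Suc (card S - d - 2)" using r by simp
        also have "r - d = Suc (r - d - 1)" using r by simp
        finally show ?thesis unfolding \<gamma>_def by simp
      qed
      have CQ: "C e \<subseteq> Q" if "e \<in> D" for e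
      proof 
        fix R assume "R \<in> C e"
        moreover have "card (insert z (D - {e})) = d" using z Dfin D that
          by (simp add: card_insert_if) (metis One_nat_def Suc_pred card_gt_0_iff empty_iff)
        ultimately show "R \<in> Q"
          using inQ[of R "insert z (D - {e})"] z D unfolding C_def B_def by auto
      qed
      have finC: "finite (\<Union>e\<in>D. C e)" using finB Dfin unfolding C_def by auto
      have "B D {} \<inter> (\<Union>e\<in>D. C e) = {}" by (auto simp: C_def B_def)
      then have "card (B D {} \<union> (\<Union>e\<in>D. C e)) = card (B D {}) + card (\<Union>e\<in>D. C e)"
        by (intro card_Un_disjoint finB finC)
      also have "card (\<Union>e\<in>D. C e) = (\<Sum>e\<in>D. card (C e))"
      proof (rule card_UN_disjoint)
        show "\<forall>e\<in>D. finite (C e)" using finB by (simp add: C_def)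
        show "\<forall>e\<in>D. \<forall>e'\<in>D. e \<noteq> e' \<longrightarrow> C e \<inter> C e' = {}" by (auto simp: C_def B_def)
      qed (rule Dfin)
      finally have "card (B D {} \<union> (\<Union>e\<in>D. C e)) = \<alpha> + (\<Sum>e\<in>D. card (C e))"
        using cB by simp
      moreover have "(\<Sum>e\<in>D. \<gamma>) \<le> (\<Sum>e\<in>D. card (C e))" using cC by (intro sum_mono) auto
      ultimately have "\<alpha> + \<gamma> * d \<le> card (B D {} \<union> (\<Union>e\<in>D. C e))"
        using D by (simp add: mult.commute)
      also have "\<dots> \<le> card Q"
        using CQ inQ D finQ by (intro card_mono) (auto simp: B_def)
      finally have a: "\<alpha> + \<gamma> * d \<le> card Q" .
      have "card T \<le> card S" using S(1) unfolding T_def by (intro card_mono) auto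
      then have "\<gamma> * card T \<le> \<gamma> * card S" by (rule mult_le_mono2)
      from add_mono[OF a this] show ?thesis
        using \<open>supports d M L U S\<close> unfolding sumT Q_def[symmetric] by simp
    qed
  next
    case False
    have "\<gamma> * card T \<le> card Q"
    proof (cases "T = {}")
      case True then show ?thesis by simp
    next
      case ne: False
      have "d \<le> card M"
      proof -
        obtain p where "supports d M L U (S - {p})" using ne unfolding T_def by auto
        then have "d \<le> card (M \<inter> (S - {p}))" unfolding supports_def by auto
        also have "\<dots> \<le> card M" using OS by (intro card_mono) auto
        finally show ?thesis .
      qed
      then have LU: "L \<noteq> {}" "U \<noteq> {}" using False unfolding supports_def OS by auto
      obtain D where D: "D \<subseteq> M" "card D = d" using \<open>d \<le> card M\<close> by (meson obtain_subset_with_card_n)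
      have Dfin: "finite D" using D OS finite_subset by auto
      \<comment> \<open>Since \<open>d \<le> card M\<close>, the set \<open>S\<close> fails only
        because both sides are occupied; a deletion repairing this removes the sole index of one
        side.\<close>
      have T: "L = {p} \<or> U = {p}" if "p \<in> T" for p
        proof -
        have "L \<inter> (S - {p}) = {} \<or> U \<inter> (S - {p}) = {}"
          using that unfolding T_def supports_def by simp
        then have "L \<subseteq> {p} \<or> U \<subseteq> {p}" using OS(2,3) by blast
        then show ?thesis using LU by blast
      qed
      obtain l u where lu: "l \<in> L" "u \<in> U" using LU by auto
      \<comment> \<open>An index on the side opposite to \<open>p\<close>. Forcing it into
        \<open>R\<close> makes the families \<open>C p\<close> disjoint: two distinct elements of
        \<open>T\<close> occupy opposite sides alone, so each is the \<open>q\<close> of the other,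
        required by one family and excluded by the other. With \<open>d + 1\<close> indices forced
        and one excluded, the count is exactly \<gamma>.\<close>
      define q where "q p = (if p \<in> L then u else l)" for p
      define C where "C p = B (insert (q p) D) {p}" for p
      have q: "q p \<noteq> p \<and> q p \<notin> D \<and> q p \<in> S \<and> p \<notin> M" if "p \<in> T" for p
      proof (cases "p \<in> L")
        case True
        then have "q p = u" by (simp add: q_def)
        moreover have "u \<notin> L" "u \<notin> M" "u \<in> S" "p \<notin> M" using lu True disj S(2) by blast+
        ultimately show ?thesis using True D(1) by auto
      next
        case False
        then have "U = {p}" using T[OF that] by blast
        have "q p = l" using False by (simp add: q_def)
        moreover have "l \<notin> U" "l \<notin> M" "l \<in> S" using lu disj S(2) by blast+
        moreover have "p \<in> U" "p \<notin> M" using \<open>U = {p}\<close> disj by blast+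
        ultimately show ?thesis using D(1) by auto
      qed
      have cC: "card (C p) = \<gamma>" if "p \<in> T" for p
      proof -
        note qp = q[OF that]
        have c: "card (insert (q p) D) = d + 1" using qp Dfin D(2) by simp
        have "insert (q p) D \<subseteq> S" "{p} \<subseteq> S" "insert (q p) D \<inter> {p} = {}"
          using qp D(1) OS(1) that unfolding T_def by blast+
        then show ?thesis
          using card_subsets_between[OF S(1), of "insert (q p) D" "{p}" r] r(1)
          unfolding B_def C_def \<gamma>_def c by simp
      qed
      have CQ: "C p \<subseteq> Q" if "p \<in> T" for p
      proof 
        fix R assume R: "R \<in> C p"
        then have "card D \<le> card (M \<inter> R)"
          using D OS by (intro card_mono) (auto simp: C_def B_def)
        then show "R \<in> Q" proof -
          have R: "R \<subseteq> S" "card R = r" "p \<notin> R" using R unfolding C_def B_def by auto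
          then have "L \<inter> R = {} \<or> U \<inter> R = {}" using T[OF that] by blast
          then show ?thesis using R(1,2) \<open>card D \<le> card (M \<inter> R)\<close> D(2)
            unfolding Q_def supports_def by simp
        qed
      qed
      have "C p \<inter> C p' = {}" if "p \<in> T" "p' \<in> T" "p \<noteq> p'" for p p'
      proof -
        have "q p = p'"
        proof (cases "p \<in> L")
          case True
          then have "L = {p}" using T[OF that(1)] disj by blast
          then have "U = {p'}" using T[OF that(2)] that(3) by blast
          then show ?thesis using True lu by (simp add: q_def)
        next
          case False
          then have "U = {p}" using T[OF that(1)] by blast
          then have "L = {p'}" using T[OF that(2)] that(3) by blast
          then show ?thesis using False lu by (simp add: q_def)
        qed
        then show ?thesis unfolding C_def B_def by auto
      qed
      then have "card (\<Union>p\<in>T. C p) = (\<Sum>p\<in>T. card (C p))"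
        using finB finT by (intro card_UN_disjoint) (auto simp: C_def)
      also have "\<dots> = \<gamma> * card T" using cC by simp
      finally have "\<gamma> * card T = card (\<Union>p\<in>T. C p)" by simp
      also have "\<dots> \<le> card Q" using CQ finQ by (intro card_mono) auto
      finally show ?thesis .
    qed
    then show ?thesis using False unfolding sumT Q_def[symmetric] by simp
  qed
qed

subsection \<open>Facets and supporting hyperplanes\<close>

lemma affine_hull_subset_hyperplane_eq:
  fixes a :: "'a::euclidean_space"
  assumes "a \<noteq> 0" "V \<subseteq> {x. a \<bullet> x = b}" "aff_dim V = int DIM('a) - 1"
  shows "affine hull V = {x. a \<bullet> x = b}"
proof (rule affine_dim_equal)
  show "affine hull V \<subseteq> {x. a \<bullet> x = b}"
    using assms(2) by (intro hull_minimal affine_hyperplane)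
  show "aff_dim (affine hull V) = aff_dim {x. a \<bullet> x = b}"
    using assms by (simp add: aff_dim_hyperplane)
  have "V \<noteq> {}" using assms(3) by (auto simp: aff_dim_empty_eq)
  then show "affine hull V \<noteq> {}" by simp
qed (auto intro: affine_hyperplane)

lemma face_of_eq_Int_affine_hull:
  fixes S :: "'a::euclidean_space set"
  assumes "F face_of S" "convex S"
  shows "F = S \<inter> affine hull F"
  using face_of_imp_eq_affine_Int[OF assms(2,1)] by (subst Int_commute)

text \<open>Faces of a polytope are exposed, which supplies a supporting hyperplane; equality of
  dimensions identifies it with the affine hull of \<open>F\<close>.\<close>

lemma ex_supporting_hyperplane_of_facet:
  fixes S :: "'a::euclidean_space set"
  assumes "finite S" "F face_of convex hull S" "aff_dim F = int DIM('a) - 1"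
  obtains a b where "a \<noteq> 0" "affine hull F = {x. a \<bullet> x = b}" "S \<subseteq> {x. a \<bullet> x \<le> b}"
proof -
  have "F exposed_face_of convex hull S"
    using assms by (simp add: exposed_face_of_polyhedron polyhedron_convex_hull)
  then consider "F = {}" | "F = convex hull S" | 
      a b where "a \<noteq> 0" "convex hull S \<subseteq> {x. a \<bullet> x \<le> b}" "F = convex hull S \<inter> {x. a \<bullet> x = b}"
    unfolding exposed_face_of by metis
  then show thesis
  proof cases
    case 1
    then show ?thesis using assms(3) by simp
  next
    case 2
    \<comment> \<open>The degenerate case: all points lie in one hyperplane and the hull is its own
      facet.\<close>
    have "aff_dim F = int (DIM('a) - 1)"
      using assms(3) DIM_positive[where 'a='a] by (simp add: of_nat_diff Suc_leI)
    then obtain a b where "a \<noteq> 0" "affine hull F = {x. a \<bullet> x = b}"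
      unfolding aff_dim_eq_hyperplane by blast
    moreover have "S \<subseteq> affine hull F"
      unfolding 2 affine_hull_convex_hull by (rule hull_subset)
    ultimately show ?thesis by (intro that[of a b]) auto
  next
    case 3
    show ?thesis
    proof (rule that[of a b])
      show "affine hull F = {x. a \<bullet> x = b}"
        using 3 assms(3) by (intro affine_hull_subset_hyperplane_eq) auto
      show "S \<subseteq> {x. a \<bullet> x \<le> b}" using 3 hull_subset[of S convex] by auto
    qed (rule 3)
  qed
qed

text \<open>Taking affine hulls is a bijection from facets to these hyperplanes. It is injective
  because a face is the hull intersected with its own affine hull, and surjective because
  \<open>d\<close> affinely independent points on \<open>H\<close> give the face cut out by
  \<open>H\<close> full dimension \<open>d - 1\<close>. General position concerns \<open>d\<close>
  points only, so a hyperplane may carry more than \<open>d\<close>; hence the count is bounded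
  below rather than fixed.\<close>

lemma num_facets_eq_card_hyperplanes:
  fixes X :: "'i \<Rightarrow> 'a::euclidean_space"
  assumes R: "finite R"
    and gp: "\<And>D. D \<subseteq> R \<Longrightarrow> card D = DIM('a) \<Longrightarrow> inj_on X D \<and> \<not> affine_dependent (X ` D)"
  shows "num_facets (convex hull (X ` R)) =
    card {H. \<exists>a b. a \<noteq> 0 \<and> H = {x. a \<bullet> x = b} \<and> DIM('a) \<le> card {i\<in>R. X i \<in> H} \<and> (\<forall>i\<in>R. a \<bullet> X i \<le> b)}"
    (is "_ = card ?K")
proof -
  let ?Z = "convex hull (X ` R)"
  let ?F = "{F. F face_of ?Z \<and> aff_dim F = int DIM('a) - 1}"
  have "inj_on (\<lambda>F. affine hull F) ?F"
  proof (rule inj_onI)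
    fix F F' assume "F \<in> ?F" "F' \<in> ?F" and eq: "affine hull F = affine hull F'"
    then have "F face_of ?Z" "F' face_of ?Z" by simp_all
    note this[THEN face_of_eq_Int_affine_hull, OF convex_convex_hull]
    then show "F = F'" using eq by metis
  qed
  then have "card ((\<lambda>F. affine hull F) ` ?F) = card ?F" by (rule card_image)
  moreover have "(\<lambda>F. affine hull F) ` ?F = ?K"
  proof (intro equalityI subsetI)
    fix H assume "H \<in> (\<lambda>F. affine hull F) ` ?F"
    then obtain F where F: "F face_of ?Z" "aff_dim F = int DIM('a) - 1" "H = affine hull F" by auto
    obtain a b where ab: "a \<noteq> 0" "affine hull F = {x. a \<bullet> x = b}" "X ` R \<subseteq> {x. a \<bullet> x \<le> b}"
      using ex_supporting_hyperplane_of_facet[of "X ` R" F] F R by auto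
    obtain T where T: "T \<subseteq> X ` R" "F = convex hull T"
      by (rule face_of_convex_hull_subset[OF _ F(1)]) (use R in \<open>auto intro: finite_imp_compact\<close>)
    have "finite T" using T R finite_subset by blast
    have "T \<subseteq> H" using T F hull_subset[of T convex] hull_subset[of F affine] by auto
    have "aff_dim T = int DIM('a) - 1" using T F by (simp add: aff_dim_convex_hull)
    then have "DIM('a) \<le> card T" using aff_dim_le_card[OF \<open>finite T\<close>] by linarith
    also have "card T \<le> card (X ` {i\<in>R. X i \<in> H})"
      using T \<open>T \<subseteq> H\<close> R by (intro card_mono) auto
    also have "\<dots> \<le> card {i\<in>R. X i \<in> H}" using R by (intro card_image_le) auto
    finally have "DIM('a) \<le> card {i\<in>R. X i \<in> H}" .
    then show "H \<in> ?K" unfolding mem_Collect_eq using ab F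
      by (intro exI[of _ a] exI[of _ b]) auto
  next
    fix H assume "H \<in> ?K"
    then obtain a b where H: "a \<noteq> 0" "H = {x. a \<bullet> x = b}" 
      "DIM('a) \<le> card {i\<in>R. X i \<in> H}" "\<forall>i\<in>R. a \<bullet> X i \<le> b" by auto
    obtain D where D: "D \<subseteq> {i\<in>R. X i \<in> H}" "card D = DIM('a)"
      using H(3) by (meson obtain_subset_with_card_n)
    have g: "inj_on X D" "\<not> affine_dependent (X ` D)" using gp[of D] D by auto
    have dD: "aff_dim (X ` D) = int DIM('a) - 1"
      using aff_dim_affine_independent[OF g(2)] D by (simp add: card_image[OF g(1)])
    define F where "F = ?Z \<inter> H"
    have "?Z \<subseteq> {x. a \<bullet> x \<le> b}"
      using H(4) by (intro hull_minimal convex_halfspace_le) auto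
    then have face: "F face_of ?Z" unfolding F_def H(2)
      by (intro face_of_Int_supporting_hyperplane_le convex_convex_hull) auto
    have "X ` D \<subseteq> F" using D hull_subset[of "X ` R" convex] unfolding F_def by auto
    then have "int DIM('a) - 1 \<le> aff_dim F" using aff_dim_subset dD by metis
    moreover have "aff_dim F \<le> int DIM('a) - 1"
      using aff_dim_subset[of F H] H(1) unfolding H(2) F_def by (auto simp: aff_dim_hyperplane)
    ultimately have "aff_dim F = int DIM('a) - 1" by simp
    moreover from this have "affine hull F = H"
      using H(1) unfolding H(2) by (intro affine_hull_subset_hyperplane_eq) (auto simp: F_def H(2))
    ultimately show "H \<in> (\<lambda>F. affine hull F) ` ?F" using face by auto
  qed
  ultimately show ?thesis unfolding num_facets_def by simp
qed

text \<open>A hyperplane does not determine its equation, so a fixed equation may have the opposite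
  orientation. Two points of \<open>V\<close> strictly on different sides would be joined by a
  segment crossing the hyperplane, which forces the endpoint \<open>x\<close> onto it.\<close>

lemma same_hyperplane_supporting:
  fixes a a' :: "'a::euclidean_space"
  assumes H: "{x. a \<bullet> x = b} = {x. a' \<bullet> x = b'}" and V: "\<And>x. x \<in> V \<Longrightarrow> a' \<bullet> x \<le> b'"
  shows "(\<forall>x\<in>V. a \<bullet> x \<le> b) \<or> (\<forall>x\<in>V. b \<le> a \<bullet> x)"
proof (rule ccontr)
  assume "\<not> ?thesis"
  then obtain x y where xy: "x \<in> V" "y \<in> V" "b < a \<bullet> x" "a \<bullet> y < b" by auto
  \<comment> \<open>Weighting each point by the distance term of the other puts the convex
    combination on the hyperplane.\<close>
  define s t where "s = b - a \<bullet> y" and "t = a \<bullet> x - b"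
  have st: "s > 0" "t > 0" using xy by (auto simp: s_def t_def)
  have "a \<bullet> (s *\<^sub>R x + t *\<^sub>R y) = (s + t) * b"
    by (simp add: inner_add_right s_def t_def algebra_simps)
  then have "(1 / (s + t)) *\<^sub>R (s *\<^sub>R x + t *\<^sub>R y) \<in> {x. a \<bullet> x = b}" using st by simp
  then have "a' \<bullet> ((1 / (s + t)) *\<^sub>R (s *\<^sub>R x + t *\<^sub>R y)) = b'" unfolding H by simp
  then have "1 / (s + t) * (s * (a' \<bullet> x) + t * (a' \<bullet> y)) = b'"
    by (simp only: inner_scaleR_right inner_add_right)
  then have "s * (a' \<bullet> x) + t * (a' \<bullet> y) = (s + t) * b'"
    using st by (simp add: divide_eq_eq mult.commute)
  moreover have "t * (a' \<bullet> y) \<le> t * b'" using V xy st by simp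
  ultimately have "s * b' \<le> s * (a' \<bullet> x)" by (simp add: algebra_simps)
  then have "a' \<bullet> x = b'" using V xy(1) st by (simp add: order_antisym)
  then show False using H xy(3) by auto
qed

text \<open>Double counting: a single finite family \<open>HH\<close> of hyperplanes serves all
  subsets \<open>R\<close> of \<open>S\<close> at once, so each facet count is a sum of indicators
  over \<open>HH\<close> and the inequality for one hyperplane can be summed.\<close>

lemma sum_num_facets_subsets:
  fixes X :: "'i \<Rightarrow> 'a::euclidean_space"
  assumes S: "finite S"
    and gp: "\<And>D. D \<subseteq> S \<Longrightarrow> card D = DIM('a) \<Longrightarrow> inj_on X D \<and> \<not> affine_dependent (X ` D)"
    and r: "DIM('a) + 1 \<le> r" "r < card S"
  defines "\<alpha> \<equiv> (card S - DIM('a)) choose (r - DIM('a))"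
    and "\<gamma> \<equiv> (card S - DIM('a) - 2) choose (r - DIM('a) - 1)"
    and "f \<equiv> (\<lambda>R. num_facets (convex hull (X ` R)))"
  shows "(\<alpha> + \<gamma> * DIM('a)) * f S + \<gamma> * (\<Sum>p\<in>S. f (S - {p}))
         \<le> (\<Sum>R | R \<subseteq> S \<and> card R = r. f R) + \<gamma> * card S * f S"
proof -
  let ?d = "DIM('a)"
  define hyp where "hyp = (\<lambda>H (a::'a) b. a \<noteq> 0 \<and> H = {x. a \<bullet> x = b})"
  define HH where "HH = {H. (\<exists>a b. hyp H a b) \<and> ?d \<le> card {i\<in>S. X i \<in> H}}"
  \<comment> \<open>Finiteness: each member is the affine hull of \<open>d\<close> sample points on
    it.\<close>
  have "HH \<subseteq> (\<lambda>D. affine hull (X ` D)) ` Pow S"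
  proof
    fix H assume "H \<in> HH"
    then obtain a b where H: "a \<noteq> 0" "H = {x. a \<bullet> x = b}" "?d \<le> card {i\<in>S. X i \<in> H}"
      unfolding HH_def hyp_def by auto
    obtain D where D: "D \<subseteq> {i\<in>S. X i \<in> H}" "card D = ?d"
      using H(3) by (meson obtain_subset_with_card_n)
    have g: "inj_on X D" "\<not> affine_dependent (X ` D)" using gp[of D] D by auto
    have "aff_dim (X ` D) = int ?d - 1"
      using aff_dim_affine_independent[OF g(2)] D by (simp add: card_image[OF g(1)])
    then have "affine hull (X ` D) = H"
      using H(1) D unfolding H(2) by (intro affine_hull_subset_hyperplane_eq) auto
    then show "H \<in> (\<lambda>D. affine hull (X ` D)) ` Pow S" using D by auto
  qed
  then have finH: "finite HH" using S finite_subset by blast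
  \<comment> \<open>One equation is fixed per hyperplane. Its orientation is arbitrary, which is
    harmless because \<open>supports\<close> is symmetric in the two sides.\<close>
  have "\<forall>H. \<exists>p. H \<in> HH \<longrightarrow> hyp H (fst p) (snd p)" unfolding HH_def by auto
  then obtain p where p: "\<And>H. H \<in> HH \<Longrightarrow> hyp H (fst (p H)) (snd (p H))" by metis
  define M where "M H = {i\<in>S. X i \<in> H}" for H
  define L where "L H = {i\<in>S. fst (p H) \<bullet> X i < snd (p H)}" for H
  define U where "U H = {i\<in>S. fst (p H) \<bullet> X i > snd (p H)}" for H
  define \<phi> where "\<phi> H R = (of_bool (supports ?d (M H) (L H) (U H) R) :: nat)" for H R
  have f: "f R = (\<Sum>H\<in>HH. \<phi> H R)" if "R \<subseteq> S" for R
  proof -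
    have "finite R" using that S finite_subset by auto
    have "{H. \<exists>a b. a \<noteq> 0 \<and> H = {x. a \<bullet> x = b} \<and> ?d \<le> card {i\<in>R. X i \<in> H} \<and> (\<forall>i\<in>R. a \<bullet> X i \<le> b)}
        = {H\<in>HH. supports ?d (M H) (L H) (U H) R}" (is "?A = ?B")
    proof (intro equalityI subsetI)
      fix H assume "H \<in> ?A"
      then obtain a b where H: "a \<noteq> 0" "H = {x. a \<bullet> x = b}" "?d \<le> card {i\<in>R. X i \<in> H}"
        "\<forall>i\<in>R. a \<bullet> X i \<le> b" by auto
      have "card {i\<in>R. X i \<in> H} \<le> card {i\<in>S. X i \<in> H}"
        using S that by (intro card_mono) auto
      then have HHH: "H \<in> HH" using H unfolding HH_def hyp_def by auto
      then have "{x. fst (p H) \<bullet> x = snd (p H)} = {x. a \<bullet> x = b}" using p H unfolding hyp_def by auto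
      then have "(\<forall>x\<in>X`R. fst (p H) \<bullet> x \<le> snd (p H)) \<or> (\<forall>x\<in>X`R. snd (p H) \<le> fst (p H) \<bullet> x)"
        using H(4) by (intro same_hyperplane_supporting) auto
      then have "L H \<inter> R = {} \<or> U H \<inter> R = {}" unfolding L_def U_def by force
      moreover have "M H \<inter> R = {i\<in>R. X i \<in> H}" using that unfolding M_def by auto
      ultimately show "H \<in> ?B" using HHH H(3) unfolding supports_def by simp
    next
      fix H assume "H \<in> ?B"
      then have H: "H \<in> HH" "?d \<le> card (M H \<inter> R)" "L H \<inter> R = {} \<or> U H \<inter> R = {}" 
        unfolding supports_def by auto
      have "M H \<inter> R = {i\<in>R. X i \<in> H}" using that unfolding M_def by auto
      then have c: "?d \<le> card {i\<in>R. X i \<in> H}" using H by simp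
      have h: "fst (p H) \<noteq> 0" "H = {x. fst (p H) \<bullet> x = snd (p H)}" using p H unfolding hyp_def by auto
      show "H \<in> ?A"
      proof (cases "U H \<inter> R = {}")
        case True
        then have "\<forall>i\<in>R. fst (p H) \<bullet> X i \<le> snd (p H)" using that unfolding U_def by force
        then show ?thesis using h c by blast
      next
        case False
        then have "\<forall>i\<in>R. (- fst (p H)) \<bullet> X i \<le> - snd (p H)" using that H(3) unfolding L_def by force
        moreover have "H = {x. (- fst (p H)) \<bullet> x = - snd (p H)}" using h by simp
        moreover have "- fst (p H) \<noteq> 0" using h by simp
        ultimately show ?thesis using c by blast
      qed
    qed
    moreover have "f R = card ?A" unfolding f_def
      by (rule num_facets_eq_card_hyperplanes) (use \<open>finite R\<close> gp that in auto)
    ultimately show ?thesis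
      using finH by (simp add: \<phi>_def sum.If_cases of_bool_def Int_def)
  qed
  have key: "(\<alpha> + \<gamma> * ?d) * \<phi> H S + \<gamma> * (\<Sum>q\<in>S. \<phi> H (S - {q}))
      \<le> (\<Sum>R | R \<subseteq> S \<and> card R = r. \<phi> H R) + \<gamma> * card S * \<phi> H S" if "H \<in> HH" for H
  proof -
    have h: "H = {x. fst (p H) \<bullet> x = snd (p H)}" using p that unfolding hyp_def by auto
    have m: "M H = {i\<in>S. fst (p H) \<bullet> X i = snd (p H)}" unfolding M_def by (subst h) auto
    have "(\<Sum>R | R \<subseteq> S \<and> card R = r. \<phi> H R) = 
        card {R. R \<subseteq> S \<and> card R = r \<and> supports ?d (M H) (L H) (U H) R}"
      using S by (simp add: \<phi>_def sum.If_cases of_bool_def Int_def)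
    moreover have "S = M H \<union> L H \<union> U H" "M H \<inter> L H = {}" "M H \<inter> U H = {}" "L H \<inter> U H = {}"
      unfolding m L_def U_def by auto
    ultimately show ?thesis
      using supports_subset_count[of S "M H" "L H" "U H" ?d r] S r
      unfolding \<alpha>_def \<gamma>_def \<phi>_def by simp
  qed
  have f1: "(\<Sum>q\<in>S. f (S - {q})) = (\<Sum>H\<in>HH. \<Sum>q\<in>S. \<phi> H (S - {q}))"
    by (subst sum.swap) (intro sum.cong refl f, auto)
  have f2: "(\<Sum>R | R \<subseteq> S \<and> card R = r. f R) = (\<Sum>H\<in>HH. \<Sum>R | R \<subseteq> S \<and> card R = r. \<phi> H R)"
    by (subst sum.swap) (intro sum.cong refl f, auto)
  show ?thesis
    unfolding f1 f2 f[OF order_refl] sum_distrib_left sum.distrib[symmetric]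
    using key unfolding sum_distrib_left by (intro sum_mono)
qed

subsection \<open>Expected facet counts of subsamples\<close>

text \<open>Any \<open>k\<close> distinct coordinates of an independent sample form an independent
  \<open>k\<close>-sample; this transfers integrals and null sets to subsamples.\<close>

lemma distr_PiM_restrict_reindex:
  assumes "prob_space P" "inj_on t {..<k}" "t ` {..<k} \<subseteq> {..<n::nat}"
  shows "(\<lambda>X. \<lambda>i\<in>{..<k::nat}. X (t i)) \<in> measurable (PiM {..<n} (\<lambda>_. P)) (PiM {..<k} (\<lambda>_. P))"
    and "distr (PiM {..<n} (\<lambda>_. P)) (PiM {..<k} (\<lambda>_. P)) (\<lambda>X. \<lambda>i\<in>{..<k}. X (t i))
           = PiM {..<k} (\<lambda>_. P)"
proof -
  show "(\<lambda>X. \<lambda>i\<in>{..<k::nat}. X (t i)) \<in> measurable (PiM {..<n} (\<lambda>_. P)) (PiM {..<k} (\<lambda>_. P))"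
    using assms(3) by (intro measurable_restrict measurable_component_singleton) auto
  show "distr (PiM {..<n} (\<lambda>_. P)) (PiM {..<k} (\<lambda>_. P)) (\<lambda>X. \<lambda>i\<in>{..<k}. X (t i))
           = PiM {..<k} (\<lambda>_. P)"
    using assms by (intro distr_PiM_reindex) auto
qed

lemma ex_enumeration:
  assumes "finite R" "card R = k"
  obtains t where "inj_on t {..<k}" "t ` {..<k} = R"
  using ex_bij_betw_nat_finite[OF assms(1)] assms(2)
  unfolding bij_betw_def atLeast0LessThan by auto

text \<open>The facet count depends only on the set of points, so after enumerating \<open>R\<close>
  it is the count for a fresh sample of size \<open>k\<close>.\<close>

lemma has_bochner_integral_num_facets_subset:
  fixes P :: "'a::euclidean_space measure" and n :: nat
  assumes P: "prob_space P" and R: "R \<subseteq> {..<n}" "card R = k" and nz: "exp_facets P k \<noteq> 0"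
  shows "has_bochner_integral (PiM {..<n} (\<lambda>_. P))
           (\<lambda>X. real (num_facets (convex hull (X ` R)))) (exp_facets P k)"
proof -
  let ?f = "\<lambda>X. real (num_facets (convex hull (X ` {..<k})))"
  obtain t where t: "inj_on t {..<k}" "t ` {..<k} = R"
    using ex_enumeration[OF finite_subset[OF R(1) finite_lessThan] R(2)] by auto
  let ?T = "\<lambda>X. \<lambda>i\<in>{..<k}. X (t i)"
  have T: "?T \<in> measurable (PiM {..<n} (\<lambda>_. P)) (PiM {..<k} (\<lambda>_. P))"
    "distr (PiM {..<n} (\<lambda>_. P)) (PiM {..<k} (\<lambda>_. P)) ?T = PiM {..<k} (\<lambda>_. P)"
    using distr_PiM_restrict_reindex[OF P t(1), of n] t(2) R(1) by auto
  \<comment> \<open>The Bochner integral of a non-integrable function is \<open>0\<close>, so no measurability proof is needed.\<close>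
  have int: "integrable (PiM {..<k} (\<lambda>_. P)) ?f"
    using nz not_integrable_integral_eq unfolding exp_facets_def by blast
  have img: "?T X ` {..<k} = X ` R" for X
  proof -
    have "?T X ` {..<k} = (\<lambda>i. X (t i)) ` {..<k}" by (intro image_cong) auto
    then show ?thesis using t(2) by (simp add: image_image[symmetric])
  qed
  have "integrable (PiM {..<n} (\<lambda>_. P)) (\<lambda>X. ?f (?T X))"
    using int T by (intro integrable_distr[OF T(1)]) simp
  moreover have "integral\<^sup>L (PiM {..<n} (\<lambda>_. P)) (\<lambda>X. ?f (?T X)) = exp_facets P k"
    using integral_distr[OF T(1), of ?f] borel_measurable_integrable[OF int] T(2)
    by (simp add: exp_facets_def)
  ultimately show ?thesis unfolding img by (simp add: has_bochner_integral_iff)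
qed

text \<open>General position transfers to each \<open>k\<close>-subset by reindexing, and there are
  only finitely many of them.\<close>

lemma AE_subset_affine_independent:
  fixes P :: "'a::euclidean_space measure" and n :: nat
  assumes P: "prob_space P"
    and gp: "AE X in PiM {..<k} (\<lambda>_. P). inj_on X {..<k} \<and> \<not> affine_dependent (X ` {..<k})"
  shows "AE X in PiM {..<n} (\<lambda>_. P). \<forall>D. D \<subseteq> {..<n} \<longrightarrow> card D = k \<longrightarrow>
           inj_on X D \<and> \<not> affine_dependent (X ` D)"
proof -
  have "AE X in PiM {..<n} (\<lambda>_. P). inj_on X D \<and> \<not> affine_dependent (X ` D)"
    if D: "D \<subseteq> {..<n}" "card D = k" for D
  proof -
    obtain t where t: "inj_on t {..<k}" "t ` {..<k} = D"
      using ex_enumeration[OF finite_subset[OF D(1) finite_lessThan] D(2)] by auto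
    let ?T = "\<lambda>X. \<lambda>i\<in>{..<k}. X (t i)"
    have T: "?T \<in> measurable (PiM {..<n} (\<lambda>_. P)) (PiM {..<k} (\<lambda>_. P))"
      "distr (PiM {..<n} (\<lambda>_. P)) (PiM {..<k} (\<lambda>_. P)) ?T = PiM {..<k} (\<lambda>_. P)"
      using distr_PiM_restrict_reindex[OF P t(1), of n] t(2) D(1) by auto
    have img: "?T X ` {..<k} = X ` D" for X
    proof -
      have "?T X ` {..<k} = (\<lambda>i. X (t i)) ` {..<k}" by (intro image_cong) auto
      then show ?thesis using t(2) by (simp add: image_image[symmetric])
    qed
    have inj: "inj_on X D" if "inj_on (?T X) {..<k}" for X
    proof -
      have "inj_on (X \<circ> t) {..<k}" using that by (simp add: inj_on_def)
      then show ?thesis using t(2) inj_on_imageI by blast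
    qed
    have "AE X in PiM {..<n} (\<lambda>_. P). inj_on (?T X) {..<k} \<and> \<not> affine_dependent (?T X ` {..<k})"
      by (rule AE_distrD[OF T(1)]) (simp only: T(2) gp)
    then show ?thesis unfolding img using inj by (auto elim: AE_mp)
  qed
  then have "AE X in PiM {..<n} (\<lambda>_. P). \<forall>D\<in>{D. D \<subseteq> {..<n} \<and> card D = k}.
           inj_on X D \<and> \<not> affine_dependent (X ` D)"
    by (intro AE_finite_allI) auto
  then show ?thesis by (rule eventually_mono) auto
qed

text \<open>Integrating the pointwise inequality over samples: each of the \<open>n\<close>
  deletions and each of the \<open>n choose r\<close> subsamples contributes the expectation for its
  size. The nonvanishing assumptions secure integrability.\<close>

lemma exp_facets_sampling_inequality:
  fixes P :: "'a::euclidean_space measure" and n :: nat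
  assumes P: "prob_space P"
    and gp: "AE X in PiM {..<DIM('a)} (\<lambda>_. P).
           inj_on X {..<DIM('a)} \<and> \<not> affine_dependent (X ` {..<DIM('a)})"
    and r: "DIM('a) + 1 \<le> r" "r < n"
    and nz: "exp_facets P n \<noteq> 0" "exp_facets P (n - 1) \<noteq> 0" "exp_facets P r \<noteq> 0"
  defines "\<alpha> \<equiv> (n - DIM('a)) choose (r - DIM('a))"
    and "\<gamma> \<equiv> (n - DIM('a) - 2) choose (r - DIM('a) - 1)"
  shows "(\<alpha> + \<gamma> * DIM('a)) * exp_facets P n + \<gamma> * (n * exp_facets P (n - 1))
         \<le> (n choose r) * exp_facets P r + \<gamma> * n * exp_facets P n"
proof -
  let ?M = "PiM {..<n} (\<lambda>_. P)"
  let ?f = "\<lambda>R X. real (num_facets (convex hull (X ` R)))"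
  let ?A = "{R. R \<subseteq> {..<n} \<and> card R = r}"
  have fS: "has_bochner_integral ?M (?f {..<n}) (exp_facets P n)"
    by (rule has_bochner_integral_num_facets_subset[OF P _ _ nz(1)]) auto
  have "has_bochner_integral ?M (\<lambda>X. \<Sum>p<n. ?f ({..<n} - {p}) X) (\<Sum>p<n. exp_facets P (n - 1))"
    by (intro has_bochner_integral_sum has_bochner_integral_num_facets_subset[OF P _ _ nz(2)]) auto
  then have fp: "has_bochner_integral ?M (\<lambda>X. \<Sum>p<n. ?f ({..<n} - {p}) X) (n * exp_facets P (n - 1))"
    by simp
  have "has_bochner_integral ?M (\<lambda>X. \<Sum>R\<in>?A. ?f R X) (\<Sum>R\<in>?A. exp_facets P r)"
    by (intro has_bochner_integral_sum has_bochner_integral_num_facets_subset[OF P _ _ nz(3)]) auto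
  then have fR: "has_bochner_integral ?M (\<lambda>X. \<Sum>R\<in>?A. ?f R X) ((n choose r) * exp_facets P r)"
    by (simp add: n_subsets)
  have 1: "has_bochner_integral ?M
      (\<lambda>X. (\<alpha> + \<gamma> * DIM('a)) * ?f {..<n} X + \<gamma> * (\<Sum>p<n. ?f ({..<n} - {p}) X))
      ((\<alpha> + \<gamma> * DIM('a)) * exp_facets P n + \<gamma> * (n * exp_facets P (n - 1)))"
    by (intro has_bochner_integral_add has_bochner_integral_mult_right fS fp)
  have 2: "has_bochner_integral ?M
      (\<lambda>X. (\<Sum>R\<in>?A. ?f R X) + real (\<gamma> * n) * ?f {..<n} X)
      ((n choose r) * exp_facets P r + real (\<gamma> * n) * exp_facets P n)"
    by (intro has_bochner_integral_add has_bochner_integral_mult_right fS fR)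
  have "AE X in ?M. (\<alpha> + \<gamma> * DIM('a)) * ?f {..<n} X + \<gamma> * (\<Sum>p<n. ?f ({..<n} - {p}) X)
          \<le> (\<Sum>R\<in>?A. ?f R X) + real (\<gamma> * n) * ?f {..<n} X"
    using AE_subset_affine_independent[OF P gp, of n]
  proof (rule AE_mp, intro AE_I2 impI)
    fix X :: "nat \<Rightarrow> 'a"
    assume "\<forall>D. D \<subseteq> {..<n} \<longrightarrow> card D = DIM('a) \<longrightarrow> inj_on X D \<and> \<not> affine_dependent (X ` D)"
    then have "(\<alpha> + \<gamma> * DIM('a)) * num_facets (convex hull (X ` {..<n}))
          + \<gamma> * (\<Sum>p<n. num_facets (convex hull (X ` ({..<n} - {p}))))
        \<le> (\<Sum>R\<in>?A. num_facets (convex hull (X ` R))) + \<gamma> * n * num_facets (convex hull (X ` {..<n}))"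
      using sum_num_facets_subsets[of "{..<n}" X r] r unfolding \<alpha>_def \<gamma>_def by simp
    then show "(\<alpha> + \<gamma> * DIM('a)) * ?f {..<n} X + \<gamma> * (\<Sum>p<n. ?f ({..<n} - {p}) X)
          \<le> (\<Sum>R\<in>?A. ?f R X) + real (\<gamma> * n) * ?f {..<n} X"
      unfolding of_nat_sum[symmetric] of_nat_mult[symmetric] of_nat_add[symmetric] of_nat_le_iff .
  qed
  then have "integral\<^sup>L ?M (\<lambda>X. (\<alpha> + \<gamma> * DIM('a)) * ?f {..<n} X + \<gamma> * (\<Sum>p<n. ?f ({..<n} - {p}) X))
     \<le> integral\<^sup>L ?M (\<lambda>X. (\<Sum>R\<in>?A. ?f R X) + real (\<gamma> * n) * ?f {..<n} X)"
    using 1 2 by (intro integral_mono_AE) (auto simp only: has_bochner_integral_iff)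
  then show ?thesis
    unfolding has_bochner_integral_integral_eq[OF 1] has_bochner_integral_integral_eq[OF 2]
    by simp
qed

subsection \<open>Asymptotics\<close>

lemma filterlim_of_ratio_tendsto:
  fixes s :: "nat \<Rightarrow> real"
  assumes "(\<lambda>n. s n / n) \<longlonglongrightarrow> \<rho>" "0 < \<rho>"
  shows "filterlim s at_top sequentially"
proof -
  have "filterlim (\<lambda>n. s n / n * real n) at_top sequentially"
    using assms by (intro filterlim_tendsto_pos_mult_at_top filterlim_real_sequentially)
  moreover have "\<forall>\<^sub>F n in sequentially. s n / n * real n = s n"
    using eventually_gt_at_top[of 0] by eventually_elim simp
  ultimately show ?thesis by (subst (asm) filterlim_cong[OF refl refl])
qed

text \<open>The quotient is the probability that a uniformly random \<open>r n\<close>-subset of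
  \<open>n\<close> elements contains \<open>a\<close> given elements and avoids \<open>b\<close>
  others. In the limit these events become independent with probabilities \<rho> and
  \<open>1 - \<rho>\<close>; the induction adds one element at a time.\<close>

lemma binomial_ratio_tendsto:
  fixes r :: "nat \<Rightarrow> nat"
  assumes r: "(\<lambda>n. r n / n) \<longlonglongrightarrow> \<rho>" "\<And>n. r n \<le> n" and \<rho>: "0 < \<rho>" "\<rho> < 1"
  shows "(\<lambda>n. real ((n - a - b) choose (r n - a)) / real (n choose r n)) \<longlonglongrightarrow> \<rho> ^ a * (1 - \<rho>) ^ b"
proof -
  \<comment> \<open>This keeps all the truncated subtractions below exact for large
    \<open>n\<close>.\<close>
  have large: "\<forall>\<^sub>F n in sequentially. k < r n \<and> k < n - r n" for k
  proof -
    have "(\<lambda>n. 1 - r n / n) \<longlonglongrightarrow> 1 - \<rho>" using r(1) by (intro tendsto_intros)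
    moreover have "\<forall>\<^sub>F n in sequentially. 1 - r n / n = real (n - r n) / n"
      using eventually_gt_at_top[of 0] by eventually_elim (use r(2) in \<open>simp add: of_nat_diff diff_divide_distrib\<close>)
    ultimately have "(\<lambda>n. real (n - r n) / n) \<longlonglongrightarrow> 1 - \<rho>" by (rule Lim_transform_eventually)
    then have "filterlim (\<lambda>n. real (n - r n)) at_top sequentially"
      by (rule filterlim_of_ratio_tendsto) (use \<rho> in simp)
    moreover have "filterlim (\<lambda>n. real (r n)) at_top sequentially"
      by (rule filterlim_of_ratio_tendsto[OF r(1) \<rho>(1)])
    ultimately have "\<forall>\<^sub>F n in sequentially. real k < real (r n)"
      "\<forall>\<^sub>F n in sequentially. real k < real (n - r n)"
      unfolding filterlim_at_top_dense by blast+
    then show ?thesis by eventually_elim auto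
  qed
  have quot: "(\<lambda>n. (r n - x) / (real n - y)) \<longlonglongrightarrow> \<rho>" for x y :: real
  proof -
    have "(\<lambda>n. (r n / n - x / n) / (1 - y / n)) \<longlonglongrightarrow> (\<rho> - 0) / (1 - 0)"
      using r(1) by (intro tendsto_intros lim_const_over_n) auto
    moreover have "\<forall>\<^sub>F n in sequentially. (r n / n - x / n) / (1 - y / n) = (r n - x) / (real n - y)"
      using eventually_gt_at_top[of 0]
    proof eventually_elim
      case (elim n)
      then have "r n / n - x / n = (r n - x) / n" "1 - y / n = (real n - y) / n"
        by (simp_all add: field_simps)
      then show ?case using elim by simp
    qed
    ultimately show ?thesis by (auto dest: Lim_transform_eventually)
  qed
  show ?thesis
  proof (induction a)
    case 0
    show ?case
    proof (induction b)
      case 0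
      have "(n choose r n) \<noteq> 0" for n
        using zero_less_binomial[OF r(2), of n] by simp
      then have "\<forall>\<^sub>F n in sequentially. 1 = real (n - 0 - 0 choose (r n - 0)) / real (n choose r n)"
        by (intro always_eventually) (simp del: binomial_eq_0_iff)
      then show ?case by (auto intro: Lim_transform_eventually)
    next
      case (Suc b)
      \<comment> \<open>One more avoided element multiplies the quotient by
        \<open>(n - b - r n) / (n - b)\<close>.\<close>
      have "(\<lambda>n. 1 - real (r n) / (real n - b)) \<longlonglongrightarrow> 1 - \<rho>"
        using quot[of 0 b] by (intro tendsto_diff tendsto_const) simp
      from tendsto_mult[OF this Suc]
      have "(\<lambda>n. (1 - real (r n) / (real n - b)) *
          (real (n - 0 - b choose (r n - 0)) / real (n choose r n))) \<longlonglongrightarrow> \<rho> ^ 0 * (1 - \<rho>) ^ Suc b"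
        by (simp add: mult_ac)
      moreover have "\<forall>\<^sub>F n in sequentially. (1 - real (r n) / (real n - b)) *
          (real (n - 0 - b choose (r n - 0)) / real (n choose r n))
          = real (n - 0 - Suc b choose (r n - 0)) / real (n choose r n)"
        using large[of b]
      proof eventually_elim
        case (elim n)
        have "(n - b - r n) * (n - b choose r n) = (n - b) * (n - b - 1 choose r n)"
          by (rule binomial_absorb_comp)
        then have "real (n - b - r n) * real (n - b choose r n) = real (n - b) * real (n - b - 1 choose r n)"
          by (metis of_nat_mult)
        moreover have "real (n - b - r n) = real n - b - r n" "real (n - b) = real n - b" "real n - b > 0"
          using elim by auto
        ultimately have "(1 - r n / (real n - b)) * real (n - b choose r n) = real (n - b - 1 choose r n)"
          by (simp add: field_simps)
        then show ?case by simp
      qed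
      ultimately show ?case by (rule Lim_transform_eventually)
    qed
  next
    case (Suc a)
    \<comment> \<open>One more required element multiplies the quotient by
      \<open>(r n - a) / (n - a - b)\<close>.\<close>
    from tendsto_mult[OF quot[of a "a + b"] Suc]
    have "(\<lambda>n. (r n - real a) / (real n - real (a + b)) *
        (real (n - a - b choose (r n - a)) / real (n choose r n))) \<longlonglongrightarrow> \<rho> ^ Suc a * (1 - \<rho>) ^ b"
      by (simp add: mult_ac)
    moreover have "\<forall>\<^sub>F n in sequentially. (r n - real a) / (real n - real (a + b)) *
          (real (n - a - b choose (r n - a)) / real (n choose r n))
          = real (n - Suc a - b choose (r n - Suc a)) / real (n choose r n)"
      using large[of "a + b"]
    proof eventually_elim
      case (elim n)
      have "Suc (r n - Suc a) * (n - a - b choose Suc (r n - Suc a)) =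
          (n - a - b) * (n - a - b - 1 choose (r n - Suc a))"
        by (rule binomial_absorption)
      moreover have "Suc (r n - Suc a) = r n - a" "n - a - b - 1 = n - Suc a - b" using elim by auto
      ultimately have "(r n - a) * (n - a - b choose (r n - a)) = (n - a - b) * (n - Suc a - b choose (r n - Suc a))"
        by simp
      then have "real (r n - a) * real (n - a - b choose (r n - a))
          = real (n - a - b) * real (n - Suc a - b choose (r n - Suc a))"
        by (metis of_nat_mult)
      moreover have "real (r n - a) = r n - real a" "real (n - a - b) = real n - real (a + b)"
        "real n - real (a + b) > 0"
        using elim by auto
      ultimately have "(r n - real a) / (real n - real (a + b)) * real (n - a - b choose (r n - a))
          = real (n - Suc a - b choose (r n - Suc a))"
        by (simp add: field_simps)
      then show ?case by simp
    qed
    ultimately show ?case by (rule Lim_transform_eventually)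
  qed
qed

text \<open>With \<open>x = 1 - \<rho>\<close>, the difference \<open>g\<close> of the two sides
  vanishes at \<open>0\<close> and has derivative \<open>- d + d + c = c\<close> there: the second
  summand cancels the first-order loss of \<open>\<rho> ^ d\<close>. As \<open>c\<close> is
  positive, \<open>g\<close> is positive just to the right of \<open>0\<close>.\<close>

lemma ex_sampling_ratio:
  fixes c :: real and d :: nat
  assumes "c > 0"
  shows "\<exists>\<rho>. 0 < \<rho> \<and> \<rho> < 1 \<and> \<rho> powr c < \<rho> ^ d + \<rho> ^ (d + 1) * (1 - \<rho>) * d"
proof -
  define g where "g x = (1 - x) ^ d + (1 - x) ^ (d + 1) * x * d - (1 - x) powr c" for x :: real
  have "(g has_real_derivative c) (at 0)"
    unfolding g_def by (auto intro!: derivative_eq_intros)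
  from DERIV_pos_inc_right[OF this assms] obtain e where
    e: "e > 0" "\<And>h. 0 < h \<Longrightarrow> h < e \<Longrightarrow> g 0 < g (0 + h)" by auto
  define x where "x = min (e / 2) (1 / 2)"
  have x: "0 < x" "x < e" "x < 1" using e(1) by (auto simp: x_def)
  have "g 0 = 0" by (simp add: g_def)
  then have "0 < g x" using e(2)[of x] x by simp
  then show ?thesis using x by (intro exI[of _ "1 - x"]) (auto simp: g_def)
qed

theorem theorem3:
  fixes P :: "'a::euclidean_space measure" and A c :: real
  assumes "prob_space P"
    and "sets P = sets borel"
    and "AE X in PiM {..<DIM('a)} (\<lambda>_. P).
           inj_on X {..<DIM('a)} \<and> \<not> affine_dependent (X ` {..<DIM('a)})"
    and "A > 0" and "c > 0"
    and "exp_facets P \<sim>[at_top] (\<lambda>n. A * real n powr c)"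
  shows "\<exists>n0::nat. \<forall>n\<ge>n0. exp_facets P (Suc n) > exp_facets P n"
proof -
  let ?d = "DIM('a)" and ?F = "exp_facets P"
  obtain \<rho> where \<rho>: "0 < \<rho>" "\<rho> < 1" "\<rho> powr c < \<rho> ^ ?d + \<rho> ^ (?d + 1) * (1 - \<rho>) * ?d"
    using ex_sampling_ratio[OF \<open>c > 0\<close>] by blast
  define r where "r n = nat \<lfloor>\<rho> * real n\<rfloor>" for n :: nat
  have r_le: "r n \<le> n" for n
  proof -
    have "\<rho> * real n \<le> real n" using \<rho> by (simp add: mult_left_le_one_le)
    then show ?thesis unfolding r_def by linarith
  qed
  have r_lim: "(\<lambda>n. r n / n) \<longlonglongrightarrow> \<rho>"
    unfolding r_def using \<rho> by real_asymp
  have r_top: "filterlim r at_top at_top"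
    using filterlim_of_ratio_tendsto[OF r_lim \<rho>(1)] filterlim_sequentially_iff_filterlim_real by blast
  define \<alpha> where "\<alpha> n = (n - ?d) choose (r n - ?d)" for n
  define \<gamma> where "\<gamma> n = (n - ?d - 2) choose (r n - ?d - 1)" for n
  have \<alpha>: "(\<lambda>n. \<alpha> n / (n choose r n)) \<longlonglongrightarrow> \<rho> ^ ?d"
    using binomial_ratio_tendsto[OF r_lim r_le \<rho>(1,2), of ?d 0] by (simp add: \<alpha>_def)
  \<comment> \<open>Here \<open>n - d - 2\<close> is read as \<open>n - (d + 1) - 1\<close>:
    \<open>d + 1\<close> required elements and one avoided.\<close>
  have \<gamma>: "(\<lambda>n. \<gamma> n / (n choose r n)) \<longlonglongrightarrow> \<rho> ^ (?d + 1) * (1 - \<rho>)"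
    using binomial_ratio_tendsto[OF r_lim r_le \<rho>(1,2), of "?d + 1" 1] by (simp add: \<gamma>_def)
  have "(\<lambda>n. \<alpha> n / (n choose r n) + \<gamma> n / (n choose r n) * ?d)
      \<longlonglongrightarrow> \<rho> ^ ?d + \<rho> ^ (?d + 1) * (1 - \<rho>) * ?d"
    by (intro tendsto_intros \<alpha> \<gamma>)
  moreover have "(\<lambda>n. ?F (r n) / ?F n) \<longlonglongrightarrow> \<rho> powr c"
  proof -
    have "(\<lambda>n. ?F (r n) / ?F n) \<sim>[at_top] (\<lambda>n. (A * real (r n) powr c) / (A * real n powr c))"
      by (intro asymp_equiv_divide asymp_equiv_compose'[OF assms(6) r_top] assms(6))
    moreover have "(\<lambda>n. (A * real (r n) powr c) / (A * real n powr c)) = (\<lambda>n. (r n / n) powr c)"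
      using \<open>A > 0\<close> by (simp add: powr_divide)
    moreover have "(\<lambda>n. (r n / n) powr c) \<longlonglongrightarrow> \<rho> powr c"
      using r_lim \<rho> by (intro tendsto_intros) auto
    ultimately show ?thesis using tendsto_asymp_equiv_cong by metis
  qed
  ultimately have "\<forall>\<^sub>F n in sequentially. 
      0 < (\<alpha> n / (n choose r n) + \<gamma> n / (n choose r n) * ?d) - ?F (r n) / ?F n"
    using \<rho>(3) by (intro order_tendstoD(1)[OF tendsto_diff]) auto
  moreover have pos: "\<forall>\<^sub>F n in sequentially. 0 < ?F n"
  proof -
    have "\<forall>\<^sub>F n in sequentially. 0 < A * real n powr c"
      using eventually_gt_at_top[of 0] by eventually_elim (use \<open>A > 0\<close> in simp)
    \<comment> \<open>Asymptotic equivalence counts the quotient \<open>0 / 0\<close> as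
      \<open>1\<close>, so simultaneous zeros must be excluded before reading it as a limit of plain
      quotients.\<close>
    moreover from this have "\<forall>\<^sub>F n in sequentially. ?F n \<noteq> 0 \<or> A * real n powr c \<noteq> 0"
      by eventually_elim (metis less_irrefl)
    then have "\<forall>\<^sub>F n in sequentially. 0 < ?F n / (A * real n powr c)"
      by (intro order_tendstoD(1)[OF asymp_equivD_strong[OF assms(6)]]) auto
    ultimately show ?thesis by eventually_elim (simp add: zero_less_divide_iff)
  qed
  \<comment> \<open>Positivity at the sizes \<open>r n\<close> and \<open>n - 1\<close> makes the
    sampling inequality applicable, since nonzero expectations guarantee integrability.\<close>
  moreover have "\<forall>\<^sub>F n in sequentially. 0 < ?F (r n)"
    using pos r_top by (rule eventually_compose_filterlim)
  moreover have "\<forall>\<^sub>F n in sequentially. 0 < ?F (n - 1)"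
    using pos filterlim_minus_const_nat_at_top by (rule eventually_compose_filterlim)
  moreover have "\<forall>\<^sub>F n in sequentially. ?d + 1 \<le> r n"
    using r_top by (simp add: filterlim_at_top)
  moreover have "\<forall>\<^sub>F n in sequentially. r n < n"
  proof -
    have "\<forall>\<^sub>F n in sequentially. r n / n < 1" using order_tendstoD(2)[OF r_lim \<rho>(2)] .
    then show ?thesis using eventually_gt_at_top[of 0] by eventually_elim simp
  qed
  ultimately have "\<forall>\<^sub>F n in sequentially. ?F (n - 1) < ?F n"
  proof eventually_elim
    case (elim n)
    have C: "real (n choose r n) > 0" using zero_less_binomial[OF r_le] by simp
    have "(\<alpha> n + \<gamma> n * ?d) * ?F n + \<gamma> n * (n * ?F (n - 1))
         \<le> (n choose r n) * ?F (r n) + \<gamma> n * n * ?F n"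
      using exp_facets_sampling_inequality[OF assms(1,3) elim(5,6)] elim(2-4)
      unfolding \<alpha>_def \<gamma>_def by simp
    \<comment> \<open>The strict gap at \<rho> lets the subsample term be dropped against the
      coefficient of \<open>?F n\<close>; only the comparison of \<open>?F (n - 1)\<close> with
      \<open>?F n\<close> remains.\<close>
    moreover have "(n choose r n) * ?F (r n) < (\<alpha> n + \<gamma> n * ?d) * ?F n"
    proof -
      have "?F (r n) / ?F n < (\<alpha> n + \<gamma> n * ?d) / (n choose r n)"
        using elim(1) by (simp add: add_divide_distrib)
      then show ?thesis using C elim(2) by (simp add: field_simps)
    qed
    ultimately have "real (\<gamma> n * n) * ?F (n - 1) < real (\<gamma> n * n) * ?F n" by simp
    \<comment> \<open>A nonnegative factor may be cancelled from a strict inequality.\<close>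
    then show ?case by (rule mult_left_less_imp_less) simp
  qed
  then obtain n0 where "\<And>n. n \<ge> n0 \<Longrightarrow> ?F (n - 1) < ?F n"
    unfolding eventually_sequentially by blast
  then have "?F n < ?F (Suc n)" if "n \<ge> n0" for n
    using that by (metis diff_Suc_1 le_SucI)
  then show ?thesis by blast
qed

end
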